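(* Let $n_1,\dots,n_t$ be positive integers, $v=n_1\cdots n_t$, and identify the finite abelian group $\mathrm{G}$ with $\prod_{l=1}^t\mathbb{Z}/n_l\mathbb{Z}$. Let $k,\lambda$ be nonnegative integers. Let $S=\{(i_1,\dots,i_t)\in\mathbb{Z}^t:0\le i_l\le n_l-1\text{ for all }l\}$ and $U=\{(\xi_1,\dots,\xi_t)\in\mathbb{C}^t:\xi_l^{n_l}=1\text{ for all }1\le l\le t\}$. Let $A=(A_{i_1\cdots i_t}:(i_1,\dots,i_t)\in S)$ be independent indeterminates, $X=(X_1,\dots,X_t)$, and define $\Psi(X,A)\in\mathbb{C}[X_1,\dots,X_t][A]$ by $$\Psi=\Big(\sum_{(i_1,\dots,i_t)\in S}A_{i_1\cdots i_t}X_1^{i_1}\cdots X_t^{i_t}\Big)\Big(\sum_{(i_1,\dots,i_t)\in S}A_{i_1\cdots i_t}X_1^{n_1-i_1}\cdots X_t^{n_t-i_t}\Big)-\lambda\Big(\sum_{(i_1,\dots,i_t)\in S}X_1^{i_1}\cdots X_t^{i_t}\Big)-(k-\lambda).$$ For $(i_1,\dots,i_t)\in S$ let $P_{i_1\cdots i_t}(A)=A_{i_1\cdots i_t}^2-A_{i_1\cdots i_t}$. Then, for $\alpha=(\alpha_{i_1\cdots i_t}:(i_1,\dots,i_t)\in S)\in\mathbb{C}^{n_1\cdots n_t}$: (1) $\alpha$ is the point representation of some subset of $\mathrm{G}$ if and only if $P_{i_1\cdots i_t}(\alpha)=0$ for all $(i_1,\dots,i_t)\in S$; (2) $\alpha$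 is the point representation of a $(v,k,\lambda)$ difference set in $\mathrm{G}$ if and only if $P_{i_1\cdots i_t}(\alpha)=0$ for all $(i_1,\dots,i_t)\in S$ and $\Psi(\xi,\alpha)=0$ for all $\xi=(\xi_1,\dots,\xi_t)\in U$.
   Context: The point representation of a subset $\mathrm{T}\subset\mathrm{G}$ is the vector $\alpha=(\alpha_{i_1\cdots i_t}:(i_1,\dots,i_t)\in S)\in\mathbb{C}^{n_1\cdots n_t}$ with $\alpha_{i_1\cdots i_t}=1$ if $(i_1+n_1\mathbb{Z},\dots,i_t+n_t\mathbb{Z})\in\mathrm{T}$ and $\alpha_{i_1\cdots i_t}=0$ otherwise (coordinates ordered in a fixed order on $S$). For a finite group $\mathrm{G}$ of order $v$ with identity $e$ and nonnegative integers $k,\lambda$, a subset $\mathrm{D}\subset\mathrm{G}$ is a $(v,k,\lambda)$ difference set if $|\mathrm{D}|=k$ and for every $g\in\mathrm{G}\setminus\{e\}$ the number of pairs $(d_1,d_2)\in\mathrm{D}\times\mathrm{D}$ with $g=d_1d_2^{-1}$ equals $\lambda$. *)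

theory Defs
  imports Complex_Main "HOL-Library.Poly_Mapping" "HOL-Algebra.Algebra"
begin

text \<open>Multivariate polynomials in the indeterminates \<open>'v\<close>: a monomial is a finitely supported
  exponent vector, and a polynomial is a finitely supported map from monomials to coefficients.\<close>

type_synonym ('a, 'v) mpoly = "('v \<Rightarrow>\<^sub>0 nat) \<Rightarrow>\<^sub>0 'a"

definition mvar :: "'v \<Rightarrow> ('a::comm_ring_1, 'v) mpoly"
  where "mvar x = Poly_Mapping.single (Poly_Mapping.single x 1) 1"

definition mconst :: "'a \<Rightarrow> ('a::comm_ring_1, 'v) mpoly"
  where "mconst c = Poly_Mapping.single 0 c"

text \<open>Evaluation at the point \<open>a\<close>, after applying the map \<open>h\<close> to the coefficients. For a polynomial
  in \<open>R[X][A]\<close>, taking for \<open>h\<close> the evaluation of \<open>X\<close> evaluates both sets of indeterminates.\<close>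

definition meval :: "('a::zero \<Rightarrow> 'b::comm_ring_1) \<Rightarrow> ('v \<Rightarrow> 'b) \<Rightarrow> ('a, 'v) mpoly \<Rightarrow> 'b"
  where "meval h a p =
    (\<Sum>m\<in>Poly_Mapping.keys p. h (Poly_Mapping.lookup p m) *
       (\<Prod>x\<in>Poly_Mapping.keys m. a x ^ Poly_Mapping.lookup m x))"

text \<open>A tuple indexed by \<open>1, \<dots>, t\<close> is a function that is \<open>undefined\<close> outside \<open>{1..t}\<close>. The library
  group \<open>integer_mod_group m\<close> has the representatives \<open>{0..<m}\<close> as carrier when \<open>m > 0\<close>.\<close>

definition cyclic_prod :: "nat \<Rightarrow> (nat \<Rightarrow> nat) \<Rightarrow> (nat \<Rightarrow> int) monoid"
  where "cyclic_prod t n = product_group {1..t} (\<lambda>l. integer_mod_group (n l))"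

definition index_set :: "nat \<Rightarrow> (nat \<Rightarrow> nat) \<Rightarrow> (nat \<Rightarrow> int) set"
  where "index_set t n = (\<Pi>\<^sub>E l\<in>{1..t}. {0..int (n l) - 1})"

definition root_tuples :: "nat \<Rightarrow> (nat \<Rightarrow> nat) \<Rightarrow> (nat \<Rightarrow> complex) set"
  where "root_tuples t n = {\<xi> \<in> {1..t} \<rightarrow>\<^sub>E UNIV. \<forall>l\<in>{1..t}. \<xi> l ^ n l = 1}"

text \<open>The element \<open>(i\<^sub>1 + n\<^sub>1\<int>, \<dots>, i\<^sub>t + n\<^sub>t\<int>)\<close> of the group.\<close>

definition residue_tuple :: "nat \<Rightarrow> (nat \<Rightarrow> nat) \<Rightarrow> (nat \<Rightarrow> int) \<Rightarrow> (nat \<Rightarrow> int)"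
  where "residue_tuple t n i = (\<lambda>l\<in>{1..t}. i l mod int (n l))"

definition point_rep ::
    "nat \<Rightarrow> (nat \<Rightarrow> nat) \<Rightarrow> (nat \<Rightarrow> int) set \<Rightarrow> ((nat \<Rightarrow> int) \<Rightarrow> complex)"
  where "point_rep t n T = (\<lambda>i\<in>index_set t n. if residue_tuple t n i \<in> T then 1 else 0)"

definition difference_set ::
    "('g, 'b) monoid_scheme \<Rightarrow> nat \<Rightarrow> nat \<Rightarrow> nat \<Rightarrow> 'g set \<Rightarrow> bool"
  where "difference_set G v k lam D \<longleftrightarrow>
    group G \<and> finite (carrier G) \<and> order G = v \<and> D \<subseteq> carrier G \<and> card D = k \<and>
    (\<forall>g\<in>carrier G - {\<one>\<^bsub>G\<^esub>}.
       card {(d1, d2). d1 \<in> D \<and> d2 \<in> D \<and> g = d1 \<otimes>\<^bsub>G\<^esub> inv\<^bsub>G\<^esub> d2} = lam)"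

text \<open>\<open>P\<^sub>i \<in> \<complex>[A]\<close>, with the indeterminates \<open>A\<close> indexed by tuples.\<close>

definition P_poly :: "(nat \<Rightarrow> int) \<Rightarrow> (complex, nat \<Rightarrow> int) mpoly"
  where "P_poly i = mvar i ^ 2 - mvar i"

text \<open>\<open>\<Psi> \<in> \<complex>[X\<^sub>1, \<dots>, X\<^sub>t][A]\<close>. All exponents are nonnegative for \<open>i\<close> in \<open>index_set t n\<close>, so
  \<open>nat\<close> does not truncate.\<close>

definition Psi_poly ::
    "nat \<Rightarrow> (nat \<Rightarrow> nat) \<Rightarrow> nat \<Rightarrow> nat \<Rightarrow> ((complex, nat) mpoly, nat \<Rightarrow> int) mpoly"
  where "Psi_poly t n k lam =
    (\<Sum>i\<in>index_set t n. mvar i * mconst (\<Prod>l=1..t. mvar l ^ nat (i l))) *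
    (\<Sum>i\<in>index_set t n. mvar i * mconst (\<Prod>l=1..t. mvar l ^ nat (int (n l) - i l))) -
    of_nat lam * (\<Sum>i\<in>index_set t n. mconst (\<Prod>l=1..t. mvar l ^ nat (i l))) -
    (of_nat k - of_nat lam)"

end

theory Submission
  imports Defs
begin

text \<open>
  Let \<open>c\<^sub>g\<close> be the number of representations \<open>g = d\<^sub>1d\<^sub>2\<^sup>-\<^sup>1\<close> with \<open>d\<^sub>1, d\<^sub>2\<close> in the set \<open>D\<close> whose
  indicator is \<open>\<alpha>\<close>. The tuples of roots of unity \<open>\<xi>\<close> are the characters of the group, and
  \<open>\<Psi>(\<xi>, \<alpha>)\<close> is the value at \<open>\<xi>\<close> of the Fourier transform of
  \<open>g \<mapsto> c\<^sub>g - \<lambda> - (k - \<lambda>)[g = e]\<close>. As \<open>c\<^sub>e = |D|\<close>, this function vanishes exactly if \<open>D\<close> is a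
  \<open>(v, k, \<lambda>)\<close> difference set, and by the orthogonality of characters it vanishes exactly if its
  Fourier transform does.
\<close>

section \<open>Evaluation of polynomials\<close>

text \<open>The coefficients of \<open>Psi_poly\<close> are polynomials themselves, so the facts
  below serve twice: for \<open>id\<close> on the complex numbers and for the evaluation at
  \<xi>.\<close>

locale comm_ring_1_hom =
  fixes h :: "'a::comm_ring_1 \<Rightarrow> 'b::comm_ring_1"
  assumes hom_add: "h (x + y) = h x + h y"
    and hom_mult: "h (x * y) = h x * h y"
    and hom_one: "h 1 = 1"
begin

lemma hom_zero: "h 0 = 0"
  using hom_add[of 0 0] by simp

lemma hom_minus: "h (x - y) = h x - h y"
  using hom_add[of "x - y" y] by simp

lemma hom_of_nat: "h (of_nat m) = of_nat m"
  by (induction m) (simp_all add: hom_zero hom_add hom_one)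

lemma hom_power: "h (x ^ m) = h x ^ m"
  by (induction m) (simp_all add: hom_one hom_mult)

lemma hom_sum: "h (sum f A) = (\<Sum>x\<in>A. h (f x))"
  by (induction A rule: infinite_finite_induct) (simp_all add: hom_zero hom_add)

lemma hom_prod: "h (prod f A) = (\<Prod>x\<in>A. h (f x))"
  by (induction A rule: infinite_finite_induct) (simp_all add: hom_one hom_mult)

end

lemma comm_ring_1_hom_id: "comm_ring_1_hom id"
  by unfold_locales simp_all

definition monom_eval :: "('v \<Rightarrow> 'b::comm_ring_1) \<Rightarrow> ('v \<Rightarrow>\<^sub>0 nat) \<Rightarrow> 'b"
  where "monom_eval a m = (\<Prod>x\<in>Poly_Mapping.keys m. a x ^ Poly_Mapping.lookup m x)"

text \<open>Outside the support the exponent is 0 and the factor is 1, so products over different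
  supports can be moved to a common finite set.\<close>

lemma monom_eval_superset:
  assumes "finite S" "Poly_Mapping.keys m \<subseteq> S"
  shows "monom_eval a m = (\<Prod>x\<in>S. a x ^ Poly_Mapping.lookup m x)"
  unfolding monom_eval_def using assms
  by (intro prod.mono_neutral_left) (auto simp: in_keys_iff)

lemma monom_eval_add: "monom_eval a (m + m') = monom_eval a m * monom_eval a m'"
proof -
  let ?S = "Poly_Mapping.keys m \<union> Poly_Mapping.keys m'"
  have "monom_eval a (m + m') = (\<Prod>x\<in>?S. a x ^ Poly_Mapping.lookup (m + m') x)"
    by (intro monom_eval_superset) (auto dest: subsetD[OF keys_add])
  also have "\<dots> = (\<Prod>x\<in>?S. a x ^ Poly_Mapping.lookup m x) *
                  (\<Prod>x\<in>?S. a x ^ Poly_Mapping.lookup m' x)"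
    by (simp add: lookup_add power_add prod.distrib)
  also have "\<dots> = monom_eval a m * monom_eval a m'"
    by (simp add: monom_eval_superset[of ?S])
  finally show ?thesis .
qed

context comm_ring_1_hom
begin

lemma meval_superset:
  assumes "finite S" "Poly_Mapping.keys p \<subseteq> S"
  shows "meval h a p = (\<Sum>m\<in>S. h (Poly_Mapping.lookup p m) * monom_eval a m)"
  unfolding meval_def monom_eval_def[symmetric] using assms
  by (intro sum.mono_neutral_left) (auto simp: in_keys_iff hom_zero)

lemma meval_add: "meval h a (p + q) = meval h a p + meval h a q"
proof -
  let ?S = "Poly_Mapping.keys p \<union> Poly_Mapping.keys q"
  have "meval h a (p + q) = (\<Sum>m\<in>?S. h (Poly_Mapping.lookup (p + q) m) * monom_eval a m)"
    by (intro meval_superset) (auto dest: subsetD[OF keys_add])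
  also have "\<dots> = (\<Sum>m\<in>?S. h (Poly_Mapping.lookup p m) * monom_eval a m) +
                  (\<Sum>m\<in>?S. h (Poly_Mapping.lookup q m) * monom_eval a m)"
    by (simp add: lookup_add hom_add algebra_simps sum.distrib)
  also have "\<dots> = meval h a p + meval h a q"
    by (simp add: meval_superset[of ?S])
  finally show ?thesis .
qed

lemma meval_zero: "meval h a 0 = 0"
  by (simp add: meval_def)

lemma meval_single: "meval h a (Poly_Mapping.single m c) = h c * monom_eval a m"
  by (subst meval_superset[of "{m}"]) auto

lemma meval_sum: "meval h a (sum f A) = (\<Sum>x\<in>A. meval h a (f x))"
  by (induction A rule: infinite_finite_induct) (simp_all add: meval_zero meval_add)

text \<open>Expanding both factors into single terms reduces the claim to monomials, where exponents
  add and \<open>monom_eval_add\<close> applies.\<close>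

lemma meval_mult: "meval h a (p * q) = meval h a p * meval h a q"
proof -
  have sum_singles:
    "r = (\<Sum>m\<in>Poly_Mapping.keys r. Poly_Mapping.single m (Poly_Mapping.lookup r m))"
    for r :: "('a, 'c) mpoly"
    by (rule poly_mapping_eqI)
       (auto simp: lookup_sum lookup_single when_def in_keys_iff)
  have "meval h a (p * q) = (\<Sum>m\<in>Poly_Mapping.keys p. \<Sum>m'\<in>Poly_Mapping.keys q.
     meval h a (Poly_Mapping.single m (Poly_Mapping.lookup p m) *
       Poly_Mapping.single m' (Poly_Mapping.lookup q m')))"
    by (subst sum_singles[of p], subst sum_singles[of q]) (simp add: sum_product meval_sum)
  also have "\<dots> = (\<Sum>m\<in>Poly_Mapping.keys p. \<Sum>m'\<in>Poly_Mapping.keys q.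
      h (Poly_Mapping.lookup p m) * h (Poly_Mapping.lookup q m') *
      (monom_eval a m * monom_eval a m'))"
    by (simp only: mult_single meval_single monom_eval_add hom_mult)
  also have "\<dots> = meval h a p * meval h a q"
    by (simp add: meval_superset[OF finite_keys subset_refl] sum_product mult_ac)
  finally show ?thesis .
qed

lemma meval_mconst: "meval h a (mconst c) = h c"
  by (simp add: mconst_def meval_single monom_eval_def)

lemma meval_mvar: "meval h a (mvar x) = a x"
  by (simp add: mvar_def meval_single monom_eval_def hom_one)

text \<open>An evaluation can thus be the coefficient map of another one: the one at \<xi> inside,
  the one at \<alpha> outside.\<close>

lemma comm_ring_1_hom_meval: "comm_ring_1_hom (meval h a)"
  by unfold_locales (simp_all add: meval_add meval_mult meval_single monom_eval_def hom_one
      flip: single_one)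

end

section \<open>Characters of products of cyclic groups\<close>

text \<open>The character given by the roots of unity \<xi>. Integer powers are taken because
  orthogonality uses the exponents \<open>g l - g' l\<close>, which may be negative.\<close>

definition char_eval :: "nat \<Rightarrow> (nat \<Rightarrow> complex) \<Rightarrow> (nat \<Rightarrow> int) \<Rightarrow> complex"
  where "char_eval t \<xi> g = (\<Prod>l=1..t. \<xi> l powi g l)"

lemma carrier_cyclic_prod:
  assumes "\<forall>l\<in>{1..t}. 0 < n l"
  shows "carrier (cyclic_prod t n) = index_set t n"
  unfolding cyclic_prod_def index_set_def carrier_product_group using assms
  by (intro PiE_cong) (auto simp: carrier_integer_mod_group)

lemma finite_index_set: "finite (index_set t n)"
  by (auto simp: index_set_def intro: finite_PiE)

lemma card_index_set: "card (index_set t n) = (\<Prod>l=1..t. n l)"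
  by (simp add: index_set_def card_PiE)

lemma group_cyclic_prod: "group (cyclic_prod t n)"
  by (simp add: cyclic_prod_def)

lemma residue_tuple_index_set: "i \<in> index_set t n \<Longrightarrow> residue_tuple t n i = i"
  by (auto simp: residue_tuple_def index_set_def PiE_iff extensional_def fun_eq_iff restrict_def)

lemma root_tuples_nonzero:
  assumes "\<xi> \<in> root_tuples t n" "l \<in> {1..t}" "0 < n l"
  shows "\<xi> l \<noteq> 0"
proof
  assume "\<xi> l = 0"
  moreover have "\<xi> l ^ n l = 1" using assms by (auto simp: root_tuples_def)
  ultimately show False using assms by (simp add: power_0_left)
qed

text \<open>This makes characters insensitive to the reductions modulo \<open>n l\<close> in the
  group operations.\<close>

lemma powi_mod_root_of_unity:
  fixes z :: complex
  assumes "z ^ m = 1" "0 < m"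
  shows "z powi (x mod int m) = z powi x"
proof -
  have "z \<noteq> 0" using assms by (auto simp: power_0_left)
  have "z powi x = z powi (int m * (x div int m) + x mod int m)" by simp
  also have "\<dots> = z powi (int m * (x div int m)) * z powi (x mod int m)"
    using \<open>z \<noteq> 0\<close> by (intro power_int_add) auto
  also have "z powi (int m * (x div int m)) = 1"
    using assms by (simp add: power_int_mult)
  finally show ?thesis by simp
qed

lemma char_eval_mult:
  assumes "\<forall>l\<in>{1..t}. 0 < n l" "\<xi> \<in> root_tuples t n"
  shows "char_eval t \<xi> (g \<otimes>\<^bsub>cyclic_prod t n\<^esub> g') = char_eval t \<xi> g * char_eval t \<xi> g'"
proof -
  have "\<xi> l powi ((g l + g' l) mod int (n l)) = \<xi> l powi g l * \<xi> l powi g' l"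
    if "l \<in> {1..t}" for l
    using that assms root_tuples_nonzero[OF assms(2) that]
    by (subst powi_mod_root_of_unity) (auto simp: root_tuples_def power_int_add)
  then show ?thesis
    by (simp add: char_eval_def cyclic_prod_def flip: prod.distrib)
qed

text \<open>The exponents on the right are those of the second factor of \<open>Psi_poly\<close>.
  For \<open>g l = 0\<close> the exponent is \<open>n l\<close> while the inverse has coordinate 0;
  a root of unity does not distinguish the two.\<close>

lemma char_eval_inv:
  assumes "\<forall>l\<in>{1..t}. 0 < n l" "\<xi> \<in> root_tuples t n" "g \<in> carrier (cyclic_prod t n)"
  shows "char_eval t \<xi> (inv\<^bsub>cyclic_prod t n\<^esub> g) = (\<Prod>l=1..t. \<xi> l powi (int (n l) - g l))"
proof -
  have "g l \<in> carrier (integer_mod_group (n l))" if "l \<in> {1..t}" for l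
    using PiE_mem[OF assms(3)[unfolded cyclic_prod_def carrier_product_group] that] .
  then have "inv\<^bsub>cyclic_prod t n\<^esub> g = (\<lambda>l\<in>{1..t}. (- g l) mod int (n l))"
    using assms(3) by (auto simp: cyclic_prod_def fun_eq_iff)
  moreover have "\<xi> l powi ((- g l) mod int (n l)) = \<xi> l powi (int (n l) - g l)"
    if "l \<in> {1..t}" for l
  proof -
    have "(int (n l) - g l) mod int (n l) = (- g l) mod int (n l)"
      by (metis add.commute mod_add_self2 uminus_add_conv_diff)
    moreover have "\<xi> l ^ n l = 1" "0 < n l"
      using that assms by (auto simp: root_tuples_def)
    ultimately show ?thesis
      by (metis powi_mod_root_of_unity)
  qed
  ultimately show ?thesis
    by (simp add: char_eval_def)
qed

text \<open>For nonzero \<open>j\<close>, multiplication by a primitive root \<omega> permutes the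
  roots and scales the sum by \<open>\<omega> powi j\<close>. The bound on \<open>j\<close> ensures
  that this scalar is not 1, so the sum is 0.\<close>

lemma sum_powi_roots_of_unity:
  assumes "0 < m" "\<bar>j\<bar> < int m"
  shows "(\<Sum>z | z ^ m = (1::complex). z powi j) = (if j = 0 then of_nat m else 0)"
proof (cases "j = 0")
  case True
  then show ?thesis using assms by (simp add: card_roots_unity_eq)
next
  case False
  define \<omega> where "\<omega> = cis (2 * pi / real m)"
  have \<omega>: "\<omega> ^ m = 1" "\<omega> \<noteq> 0"
    using assms by (simp_all add: \<omega>_def DeMoivre)
  have "\<omega> ^ nat \<bar>j\<bar> \<noteq> 1"
  proof
    assume *: "\<omega> ^ nat \<bar>j\<bar> = 1"
    have cis: "\<omega> ^ i = cis (2 * pi * real i / real m)" for i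
      unfolding \<omega>_def DeMoivre by (simp add: mult_ac)
    \<comment> \<open>The powers of \<omega> with exponents below \<open>m\<close> list the roots
      without repetition; the absolute value of \<open>j\<close> and 0 are two such
      exponents.\<close>
    have "inj_on (\<lambda>i. \<omega> ^ i) {..<m}"
      unfolding cis using bij_betw_roots_unity[OF assms(1)] by (simp add: bij_betw_def)
    moreover have "nat \<bar>j\<bar> \<in> {..<m}" "0 \<in> {..<m}"
      using assms by auto
    ultimately have "nat \<bar>j\<bar> = 0"
      using * by (metis inj_onD power_0)
    then show False using False by simp
  qed
  \<comment> \<open>For negative \<open>j\<close> this power is the inverse of the one just
    treated.\<close>
  then have "\<omega> powi j \<noteq> 1"
    by (auto simp: power_int_def power_inverse abs_if split: if_splits)
  have "bij_betw (\<lambda>z. \<omega> * z) {z. z ^ m = 1} {z. z ^ m = 1}"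
    using \<omega> by (intro bij_betwI[where g = "\<lambda>z. z / \<omega>"]) (auto simp: power_mult_distrib power_divide)
  then have "(\<Sum>z | z ^ m = 1. z powi j) = (\<Sum>z | z ^ m = 1. (\<omega> * z) powi j)"
    by (rule sum.reindex_bij_betw[symmetric])
  also have "\<dots> = \<omega> powi j * (\<Sum>z | z ^ m = 1. z powi j)"
    by (simp add: power_int_mult_distrib sum_distrib_left)
  finally show ?thesis
    using \<open>\<omega> powi j \<noteq> 1\<close> False by simp
qed

text \<open>Orthogonality with the group elements fixed and the character varying. Since
  \<open>root_tuples\<close> is a product set, the sum factors into one sum over roots of unity per
  coordinate.\<close>

lemma sum_char_eval_root_tuples:
  assumes "\<forall>l\<in>{1..t}. 0 < n l" "g \<in> index_set t n" "g' \<in> index_set t n"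
  shows "(\<Sum>\<xi>\<in>root_tuples t n. char_eval t \<xi> (\<lambda>l. g l - g' l)) =
    (if g = g' then of_nat (\<Prod>l=1..t. n l) else 0)"
proof -
  have "root_tuples t n = (\<Pi>\<^sub>E l\<in>{1..t}. {z. z ^ n l = 1})"
    by (auto simp: root_tuples_def PiE_iff extensional_def)
  then have "(\<Sum>\<xi>\<in>root_tuples t n. char_eval t \<xi> (\<lambda>l. g l - g' l)) =
      (\<Prod>l=1..t. \<Sum>z | z ^ n l = 1. z powi (g l - g' l))"
    unfolding char_eval_def using assms
    by (simp only:) (subst prod_sum_PiE, auto intro!: finite_roots_unity simp: Suc_le_eq)
  also have "\<dots> = (\<Prod>l=1..t. if g l = g' l then of_nat (n l) else 0)"
  proof (rule prod.cong[OF refl])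
    fix l assume l: "l \<in> {1..t}"
    then have "g l \<in> {0..int (n l) - 1}" "g' l \<in> {0..int (n l) - 1}"
      using assms by (auto simp: index_set_def)
    then show "(\<Sum>z | z ^ n l = 1. z powi (g l - g' l)) = (if g l = g' l then of_nat (n l) else 0 :: complex)"
      using assms l by (subst sum_powi_roots_of_unity) auto
  qed
  also have "\<dots> = (if g = g' then of_nat (\<Prod>l=1..t. n l) else 0)"
  proof (cases "g = g'")
    case False
    \<comment> \<open>Both tuples are extensional, so they differ at an index in
      \<open>{1..t}\<close>, whose factor is 0.\<close>
    then obtain l where "l \<in> {1..t}" "g l \<noteq> g' l"
      using assms PiE_ext unfolding index_set_def by blast
    then show ?thesis using False by (auto intro!: prod_zero)
  qed simp
  finally show ?thesis .
qed

text \<open>Fourier inversion: summing the transform against the inverse character values at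
  \<open>g'\<close> leaves \<open>f g'\<close> times the group order.\<close>

lemma fourier_transform_eq_0_iff:
  fixes f :: "(nat \<Rightarrow> int) \<Rightarrow> complex"
  assumes "\<forall>l\<in>{1..t}. 0 < n l"
  shows "(\<forall>\<xi>\<in>root_tuples t n. (\<Sum>g\<in>index_set t n. f g * char_eval t \<xi> g) = 0) \<longleftrightarrow>
    (\<forall>g\<in>index_set t n. f g = 0)"
proof (intro iffI ballI)
  fix g' assume transform: "\<forall>\<xi>\<in>root_tuples t n. (\<Sum>g\<in>index_set t n. f g * char_eval t \<xi> g) = 0"
    and g': "g' \<in> index_set t n"
  have diff: "char_eval t \<xi> (\<lambda>l. g l - g' l) = char_eval t \<xi> g * inverse (char_eval t \<xi> g')"
    if "\<xi> \<in> root_tuples t n" for \<xi> g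
    unfolding char_eval_def prod_inversef[symmetric] prod.distrib[symmetric]
    using root_tuples_nonzero[OF that] assms
    by (intro prod.cong) (auto simp: power_int_diff divide_inverse)
  have "f g' * of_nat (\<Prod>l=1..t. n l) =
      (\<Sum>g\<in>index_set t n. f g * (if g = g' then of_nat (\<Prod>l=1..t. n l) else 0))"
    using g' by (simp add: if_distrib finite_index_set cong: if_cong)
  also have "\<dots> = (\<Sum>g\<in>index_set t n. f g *
      (\<Sum>\<xi>\<in>root_tuples t n. char_eval t \<xi> (\<lambda>l. g l - g' l)))"
    using assms g' by (simp add: sum_char_eval_root_tuples)
  also have "\<dots> = (\<Sum>\<xi>\<in>root_tuples t n.
      (\<Sum>g\<in>index_set t n. f g * char_eval t \<xi> g) * inverse (char_eval t \<xi> g'))"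
    unfolding sum_distrib_left sum_distrib_right
    by (subst sum.swap) (intro sum.cong refl, simp add: diff)
  also have "\<dots> = 0"
    using transform by simp
  \<comment> \<open>The factor to cancel is nonzero because every \<open>n l\<close> is
    positive.\<close>
  finally show "f g' = 0"
    using assms by auto
qed simp

section \<open>Difference sets\<close>

definition diff_count :: "('g, 'b) monoid_scheme \<Rightarrow> 'g set \<Rightarrow> 'g \<Rightarrow> nat"
  where "diff_count G D g =
    card {(d1, d2). d1 \<in> D \<and> d2 \<in> D \<and> g = d1 \<otimes>\<^bsub>G\<^esub> inv\<^bsub>G\<^esub> d2}"

text \<open>Only the diagonal pairs have trivial quotient.\<close>

lemma (in group) diff_count_one:
  assumes "D \<subseteq> carrier G"
  shows "diff_count G D \<one> = card D"
proof -
  have "d1 = d2" if "d1 \<in> D" "d2 \<in> D" "\<one> = d1 \<otimes> inv d2" for d1 d2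
    using that assms by (metis inv_closed inv_equality inv_inv subsetD)
  then have "{(d1, d2). d1 \<in> D \<and> d2 \<in> D \<and> \<one> = d1 \<otimes> inv d2} = (\<lambda>d. (d, d)) ` D"
    using assms by (auto simp: subset_iff)
  then show ?thesis
    by (simp add: diff_count_def card_image inj_on_def)
qed

text \<open>The coefficient of \<open>g\<close> in the group ring element D D' - lam G - (k - lam)
  e, where D' is the sum of the inverses of the elements of \<open>D\<close>.\<close>

definition diff_defect :: "('g, 'b) monoid_scheme \<Rightarrow> nat \<Rightarrow> nat \<Rightarrow> 'g set \<Rightarrow> 'g \<Rightarrow> complex"
  where "diff_defect G k lam D g =
    of_nat (diff_count G D g) - of_nat lam - (if g = \<one>\<^bsub>G\<^esub> then of_nat k - of_nat lam else 0)"

text \<open>At the identity the terms in \<open>lam\<close> cancel and the defect is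
  \<open>card D - k\<close>, so its vanishing there encodes the size condition.\<close>

lemma (in group) difference_set_iff_defect:
  assumes "D \<subseteq> carrier G" "finite (carrier G)"
  shows "difference_set G (order G) k lam D \<longleftrightarrow> (\<forall>g\<in>carrier G. diff_defect G k lam D g = 0)"
proof -
  have "diff_defect G k lam D \<one> = 0 \<longleftrightarrow> card D = k"
    by (simp add: diff_defect_def diff_count_one[OF assms(1)])
  moreover have "diff_defect G k lam D g = 0 \<longleftrightarrow> diff_count G D g = lam" if "g \<noteq> \<one>" for g
    using that by (simp add: diff_defect_def)
  ultimately show ?thesis
    using assms is_group unfolding difference_set_def diff_count_def[symmetric]
    by (metis DiffE DiffI insertI1 one_closed singletonD)
qed

text \<open>The pairs in \<open>D \<times> D\<close> are sorted by their quotient; by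
  multiplicativity each contributes the value of \<chi> at that quotient.\<close>

lemma (in group) sum_mult_sum_inv:
  fixes \<chi> :: "'a \<Rightarrow> complex"
  assumes "D \<subseteq> carrier G" "finite (carrier G)" "\<And>x y. \<chi> (x \<otimes> y) = \<chi> x * \<chi> y"
  shows "(\<Sum>d\<in>D. \<chi> d) * (\<Sum>d\<in>D. \<chi> (inv d)) = (\<Sum>g\<in>carrier G. of_nat (diff_count G D g) * \<chi> g)"
proof -
  have finD: "finite D" using assms finite_subset by blast
  have "(\<Sum>d\<in>D. \<chi> d) * (\<Sum>d\<in>D. \<chi> (inv d)) = (\<Sum>(d1, d2)\<in>D \<times> D. \<chi> (d1 \<otimes> inv d2))"
    by (simp add: sum_product sum.cartesian_product assms(3))
  also have "\<dots> = (\<Sum>g\<in>carrier G. \<Sum>(d1, d2) | (d1, d2) \<in> D \<times> D \<and> d1 \<otimes> inv d2 = g. \<chi> (d1 \<otimes> inv d2))"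
    using assms finD
    by (subst sum.group[of "D \<times> D" "carrier G" "\<lambda>(d1, d2). d1 \<otimes> inv d2", symmetric])
       (auto simp: case_prod_unfold subset_iff mem_Times_iff conj_assoc)
  also have "\<dots> = (\<Sum>g\<in>carrier G. \<Sum>(d1, d2) | (d1, d2) \<in> D \<times> D \<and> d1 \<otimes> inv d2 = g. \<chi> g)"
    by (intro sum.cong refl) auto
  also have "\<dots> = (\<Sum>g\<in>carrier G. of_nat (diff_count G D g) * \<chi> g)"
    by (intro sum.cong refl) (simp add: diff_count_def case_prod_unfold mem_Times_iff
        conj_assoc eq_commute[of _ "_ \<otimes> _"])
  finally show ?thesis .
qed

section \<open>Evaluation of \<open>P_poly\<close> and \<open>Psi_poly\<close> at point
  representations\<close>

lemma point_rep_eq_indicator: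
  "point_rep t n T = (\<lambda>i\<in>index_set t n. if i \<in> T then 1 else 0)"
  by (auto simp: point_rep_def residue_tuple_index_set fun_eq_iff)

lemma meval_P_poly: "meval id \<alpha> (P_poly i) = \<alpha> i ^ 2 - \<alpha> i"
proof -
  interpret id: comm_ring_1_hom "id :: complex \<Rightarrow> complex" by (rule comm_ring_1_hom_id)
  interpret ev: comm_ring_1_hom "meval (id :: complex \<Rightarrow> complex) \<alpha>"
    by (rule id.comm_ring_1_hom_meval)
  show ?thesis
    by (simp add: P_poly_def ev.hom_minus ev.hom_power id.meval_mvar)
qed

lemma meval_Psi_poly:
  "meval (meval id \<xi>) \<alpha> (Psi_poly t n k lam) =
    (\<Sum>i\<in>index_set t n. \<alpha> i * char_eval t \<xi> i) *
    (\<Sum>i\<in>index_set t n. \<alpha> i * (\<Prod>l=1..t. \<xi> l powi (int (n l) - i l))) -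
    of_nat lam * (\<Sum>i\<in>index_set t n. char_eval t \<xi> i) - (of_nat k - of_nat lam)"
proof -
  interpret id: comm_ring_1_hom "id :: complex \<Rightarrow> complex" by (rule comm_ring_1_hom_id)
  interpret evX: comm_ring_1_hom "meval (id :: complex \<Rightarrow> complex) \<xi>"
    by (rule id.comm_ring_1_hom_meval)
  interpret ev: comm_ring_1_hom "meval (meval (id :: complex \<Rightarrow> complex) \<xi>) \<alpha>"
    by (rule evX.comm_ring_1_hom_meval)
  have "(\<Prod>l=1..t. \<xi> l ^ nat (i l)) = char_eval t \<xi> i"
    "(\<Prod>l=1..t. \<xi> l ^ nat (int (n l) - i l)) = (\<Prod>l=1..t. \<xi> l powi (int (n l) - i l))"
    if "i \<in> index_set t n" for i
  proof -
    \<comment> \<open>These bounds make both exponents nonnegative, so the powers with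
      \<open>nat\<close> agree with \<open>powi\<close>.\<close>
    have "0 \<le> i l \<and> i l \<le> int (n l)" if "l \<in> {1..t}" for l
      using PiE_mem[OF \<open>i \<in> index_set t n\<close>[unfolded index_set_def] that] by simp
    then show "(\<Prod>l=1..t. \<xi> l ^ nat (i l)) = char_eval t \<xi> i"
      "(\<Prod>l=1..t. \<xi> l ^ nat (int (n l) - i l)) = (\<Prod>l=1..t. \<xi> l powi (int (n l) - i l))"
      unfolding char_eval_def by (auto intro!: prod.cong simp: power_int_def)
  qed
  then show ?thesis
    by (simp add: Psi_poly_def ev.hom_minus ev.hom_mult ev.hom_sum ev.hom_of_nat
        evX.meval_mvar evX.meval_mconst evX.hom_prod evX.hom_power id.meval_mvar cong: sum.cong)
qed

text \<open>Each term of \<open>Psi_poly\<close> becomes a Fourier transform: the product that of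
  \<open>diff_count\<close>, the middle sum that of the constant \<open>lam\<close>, and
  \<open>k - lam\<close> that of a function supported at the identity, where characters are
  1.\<close>

lemma meval_Psi_poly_point_rep:
  fixes t :: nat and n :: "nat \<Rightarrow> nat"
  defines "G \<equiv> cyclic_prod t n"
  assumes n: "\<forall>l\<in>{1..t}. 0 < n l" and \<xi>: "\<xi> \<in> root_tuples t n" and D: "D \<subseteq> carrier G"
  shows "meval (meval id \<xi>) (point_rep t n D) (Psi_poly t n k lam) =
    (\<Sum>g\<in>index_set t n. diff_defect G k lam D g * char_eval t \<xi> g)"
proof -
  interpret group G unfolding G_def by (rule group_cyclic_prod)
  have carrier: "carrier G = index_set t n"
    unfolding G_def using n by (rule carrier_cyclic_prod)
  have indicator: "(\<Sum>i\<in>index_set t n. point_rep t n D i * f i) = sum f D" for f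
  proof -
    have "(\<Sum>i\<in>index_set t n. point_rep t n D i * f i) = (\<Sum>i\<in>index_set t n. if i \<in> D then f i else 0)"
      by (intro sum.cong) (auto simp: point_rep_eq_indicator)
    also have "\<dots> = sum f D"
      using D carrier by (simp add: sum.inter_restrict[symmetric] finite_index_set Int_absorb1)
    finally show ?thesis .
  qed
  have inv: "(\<Sum>i\<in>D. \<Prod>l=1..t. \<xi> l powi (int (n l) - i l)) = (\<Sum>i\<in>D. char_eval t \<xi> (inv\<^bsub>G\<^esub> i))"
    using D char_eval_inv[OF n \<xi>] unfolding G_def by (intro sum.cong) auto
  have mult: "char_eval t \<xi> (g \<otimes>\<^bsub>G\<^esub> g') = char_eval t \<xi> g * char_eval t \<xi> g'" for g g'
    unfolding G_def by (rule char_eval_mult[OF n \<xi>])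
  have one: "char_eval t \<xi> \<one>\<^bsub>G\<^esub> = 1"
    by (simp add: G_def cyclic_prod_def char_eval_def)
  have const: "(\<Sum>g\<in>index_set t n. (if g = \<one>\<^bsub>G\<^esub> then of_nat k - of_nat lam else 0) * char_eval t \<xi> g) =
      (of_nat k - of_nat lam)"
    using one_closed by (simp add: carrier if_distrib[of "\<lambda>x. x * _"] finite_index_set one cong: if_cong)
  have product: "(\<Sum>d\<in>D. char_eval t \<xi> d) * (\<Sum>d\<in>D. char_eval t \<xi> (inv\<^bsub>G\<^esub> d)) =
      (\<Sum>g\<in>index_set t n. of_nat (diff_count G D g) * char_eval t \<xi> g)"
    using sum_mult_sum_inv[OF D _ mult] by (simp add: carrier finite_index_set)
  show ?thesis
    unfolding meval_Psi_poly indicator inv product diff_defect_def left_diff_distrib sum_subtractf const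
    by (simp add: sum_distrib_left)
qed

theorem theorem3p2:
  fixes t :: nat and n :: "nat \<Rightarrow> nat" and v k lam :: nat
    and \<alpha> :: "(nat \<Rightarrow> int) \<Rightarrow> complex"
  assumes "\<forall>l\<in>{1..t}. 0 < n l"
    and "v = (\<Prod>l=1..t. n l)"
    and "\<alpha> \<in> index_set t n \<rightarrow>\<^sub>E UNIV"
  shows "((\<exists>T. T \<subseteq> carrier (cyclic_prod t n) \<and> \<alpha> = point_rep t n T) \<longleftrightarrow>
           (\<forall>i\<in>index_set t n. meval id \<alpha> (P_poly i) = 0)) \<and>
         ((\<exists>D. difference_set (cyclic_prod t n) v k lam D \<and> \<alpha> = point_rep t n D) \<longleftrightarrow>
           (\<forall>i\<in>index_set t n. meval id \<alpha> (P_poly i) = 0) \<and>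
           (\<forall>\<xi>\<in>root_tuples t n. meval (meval id \<xi>) \<alpha> (Psi_poly t n k lam) = 0))"
proof -
  let ?G = "cyclic_prod t n"
  interpret group ?G by (rule group_cyclic_prod)
  have carrier: "carrier ?G = index_set t n"
    using assms(1) by (rule carrier_cyclic_prod)
  have v: "v = order ?G"
    by (simp add: order_def carrier card_index_set assms(2))
  have points: "(\<exists>T. T \<subseteq> carrier ?G \<and> \<alpha> = point_rep t n T) \<longleftrightarrow>
      (\<forall>i\<in>index_set t n. meval id \<alpha> (P_poly i) = 0)" (is "?subset \<longleftrightarrow> ?P")
  proof
    assume ?subset
    then show ?P by (auto simp: point_rep_eq_indicator meval_P_poly)
  next
    assume ?P
    then have "\<alpha> i = 0 \<or> \<alpha> i = 1" if "i \<in> index_set t n" for i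
      using that by (auto simp: meval_P_poly power2_eq_square)
    \<comment> \<open>Outside \<open>index_set\<close> both sides are \<open>undefined\<close>, for
      \<alpha> by the third assumption.\<close>
    then have "\<alpha> = point_rep t n {i \<in> index_set t n. \<alpha> i = 1}"
      using assms(3) by (fastforce simp: point_rep_eq_indicator fun_eq_iff PiE_iff extensional_def)
    then show ?subset
      using carrier by (intro exI[of _ "{i \<in> index_set t n. \<alpha> i = 1}"]) auto
  qed
  have "difference_set ?G v k lam D \<longleftrightarrow>
      (\<forall>\<xi>\<in>root_tuples t n. meval (meval id \<xi>) (point_rep t n D) (Psi_poly t n k lam) = 0)"
    if D: "D \<subseteq> carrier ?G" for D
    using difference_set_iff_defect[OF D] fourier_transform_eq_0_iff[OF assms(1)]
    by (simp add: v carrier finite_index_set meval_Psi_poly_point_rep[OF assms(1) _ D])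
  moreover have "D \<subseteq> carrier ?G" if "difference_set ?G v k lam D" for D
    using that by (simp add: difference_set_def)
  \<comment> \<open>From right to left, \<open>points\<close> supplies a set represented by
    \<alpha>, to which the equivalence for subsets applies.\<close>
  ultimately have "(\<exists>D. difference_set ?G v k lam D \<and> \<alpha> = point_rep t n D) \<longleftrightarrow>
      ?P \<and> (\<forall>\<xi>\<in>root_tuples t n. meval (meval id \<xi>) \<alpha> (Psi_poly t n k lam) = 0)"
    unfolding points[symmetric] by metis
  with points show ?thesis by blast
qed

end
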